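(* Let $T$ be a tree with at least two vertices. Then $T$ has an interval coloring $\alpha$ such that $USE(V(T),\alpha)$ is continuous.
   Context: A proper edge-coloring $\alpha$ with consecutive integers $c_1,\ldots,c_t$ is an interval $t$-coloring if all $t$ colors are used and for every vertex $v$ the spectrum $S(v,\alpha)$ (set of colors on edges incident to $v$) is an interval of integers; an interval coloring is an interval $t$-coloring for some $t$. $\overline S(v,\alpha)=\max S(v,\alpha)$. $USE(V(T),\alpha)$ is the sequence of the numbers $\overline S(v,\alpha)$, $v\in V(T)$ (with multiplicity), arranged in nondecreasing order. A nondecreasing sequence of integers is continuous if it contains every integer between its smallest and largest element. *)

theory Defs
  imports "Graph_Theory.Digraph_Component" "HOL-Library.Multiset"
begin

text \<open>
  As in \<^theory>\<open>Graph_Theory.Digraph\<close>, a finite simple graph is a finite symmetric loop-free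
  digraph (\<^locale>\<open>pair_graph\<close>): every undirected edge is represented by two opposite arcs.
  An edge-coloring must give both arcs the same color, so it is a function on two-element
  vertex sets.
\<close>

definition uedges :: "'a pair_pre_digraph \<Rightarrow> 'a set set" where
  "uedges G = {{u, v} | u v. (u, v) \<in> parcs G}"

text \<open>
  The library predicate \<open>tree\<close> is not the undirected notion on symmetric digraphs, since it counts
  the closed walk \<open>u, v, u\<close> as a cycle. Cycles of the underlying undirected graph are exactly
  the directed cycles of length at least three.
\<close>

definition undirected_tree :: "'a pair_pre_digraph \<Rightarrow> bool" where
  "undirected_tree G \<longleftrightarrow>
     pair_graph G \<and> connected (with_proj G) \<and>
     \<not> (\<exists>p. pre_digraph.cycle (with_proj G) p \<and> 3 \<le> length p)"

definition proper_edge_coloring :: "'a pair_pre_digraph \<Rightarrow> ('a set \<Rightarrow> int) \<Rightarrow> bool" where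
  "proper_edge_coloring G \<alpha> \<longleftrightarrow>
     (\<forall>e \<in> uedges G. \<forall>f \<in> uedges G. e \<noteq> f \<and> e \<inter> f \<noteq> {} \<longrightarrow> \<alpha> e \<noteq> \<alpha> f)"

definition spectrum :: "'a pair_pre_digraph \<Rightarrow> ('a set \<Rightarrow> int) \<Rightarrow> 'a \<Rightarrow> int set" where
  "spectrum G \<alpha> v = \<alpha> ` {e \<in> uedges G. v \<in> e}"

definition int_interval :: "int set \<Rightarrow> bool" where
  "int_interval S \<longleftrightarrow> (\<exists>a b. S = {a..b})"

definition interval_t_coloring :: "'a pair_pre_digraph \<Rightarrow> nat \<Rightarrow> ('a set \<Rightarrow> int) \<Rightarrow> bool" where
  "interval_t_coloring G t \<alpha> \<longleftrightarrow>
     proper_edge_coloring G \<alpha> \<and>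
     (\<exists>c. \<alpha> ` uedges G = {c..<c + int t}) \<and>
     (\<forall>v \<in> pverts G. int_interval (spectrum G \<alpha> v))"

definition interval_coloring :: "'a pair_pre_digraph \<Rightarrow> ('a set \<Rightarrow> int) \<Rightarrow> bool" where
  "interval_coloring G \<alpha> \<longleftrightarrow> (\<exists>t. interval_t_coloring G t \<alpha>)"

text \<open>Meaningful only for non-isolated vertices \<open>v\<close>, whose spectrum is nonempty.\<close>

definition upper_spectrum :: "'a pair_pre_digraph \<Rightarrow> ('a set \<Rightarrow> int) \<Rightarrow> 'a \<Rightarrow> int" where
  "upper_spectrum G \<alpha> v = Max (spectrum G \<alpha> v)"

definition USE :: "'a pair_pre_digraph \<Rightarrow> 'a set \<Rightarrow> ('a set \<Rightarrow> int) \<Rightarrow> int list" where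
  "USE G W \<alpha> = sorted_list_of_multiset (image_mset (upper_spectrum G \<alpha>) (mset_set W))"

text \<open>Meaningful only for nonempty sequences.\<close>

definition continuous_seq :: "int list \<Rightarrow> bool" where
  "continuous_seq xs \<longleftrightarrow> sorted xs \<and> {Min (set xs)..Max (set xs)} \<subseteq> set xs"

end

theory Submission
  imports Defs
begin

text \<open>
  Grow the tree one leaf at a time, keeping an interval coloring in which the set of upper spectra
  of the vertices equals the set of used colors. When a leaf \<open>w\<close> is attached to \<open>u\<close>, give the new
  edge the color just below the spectrum of \<open>u\<close>: all old upper spectra, that of \<open>u\<close>
  included, stay the same, and the upper spectrum of \<open>w\<close> is the color of the new edge, which
  is at least the smallest used color minus one.
\<close>

text \<open>Stated for bare vertex and edge sets, so that it applies to every intermediate subtree.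
  The condition \<open>a \<le> b\<close> makes each spectrum at a vertex of \<open>V\<close>
  nonempty, so that \<open>Max\<close> is meaningful. The last conjunct is the invariant that yields
  continuity.\<close>

definition top_coloring :: "'a set \<Rightarrow> 'a set set \<Rightarrow> ('a set \<Rightarrow> int) \<Rightarrow> bool" where
  "top_coloring V E \<alpha> \<longleftrightarrow>
     (\<forall>e\<in>E. \<forall>f\<in>E. e \<noteq> f \<and> e \<inter> f \<noteq> {} \<longrightarrow> \<alpha> e \<noteq> \<alpha> f) \<and>
     (\<exists>a b. \<alpha> ` E = {a..b}) \<and>
     (\<forall>v\<in>V. \<exists>a b. a \<le> b \<and> \<alpha> ` {e\<in>E. v \<in> e} = {a..b}) \<and>
     (\<lambda>v. Max (\<alpha> ` {e\<in>E. v \<in> e})) ` V = \<alpha> ` E"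

lemma top_coloringD:
  assumes "top_coloring V E \<alpha>"
  shows "\<forall>e\<in>E. \<forall>f\<in>E. e \<noteq> f \<and> e \<inter> f \<noteq> {} \<longrightarrow> \<alpha> e \<noteq> \<alpha> f"
    and "\<exists>a b. \<alpha> ` E = {a..b}"
    and "\<forall>v\<in>V. \<exists>a b. a \<le> b \<and> \<alpha> ` {e\<in>E. v \<in> e} = {a..b}"
    and "(\<lambda>v. Max (\<alpha> ` {e\<in>E. v \<in> e})) ` V = \<alpha> ` E"
  using assms unfolding top_coloring_def by - (elim conjE, assumption)+

lemma top_coloring_single_edge: "top_coloring {u, w} {{u, w}} (\<lambda>_. 0)"
proof -
  have spec: "(\<lambda>_. 0::int) ` {e \<in> {{u, w}}. v \<in> e} = {0}" if "v \<in> {u, w}" for v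
    using that by auto
  show ?thesis
    unfolding top_coloring_def
  proof (intro conjI ballI)
    show "\<exists>a b. (\<lambda>_. 0::int) ` {{u, w}} = {a..b}"
      by (intro exI[of _ 0]) simp
    show "\<exists>a b. a \<le> b \<and> (\<lambda>_. 0::int) ` {e \<in> {{u, w}}. v \<in> e} = {a..b}"
      if "v \<in> {u, w}" for v
      using spec[OF that] by (intro exI[of _ 0]) simp
    show "(\<lambda>v. Max ((\<lambda>_. 0::int) ` {e \<in> {{u, w}}. v \<in> e})) ` {u, w} = (\<lambda>_. 0) ` {{u, w}}"
      using spec by simp
  qed simp
qed

section \<open>Attaching a leaf\<close>

text \<open>Extending the spectrum of \<open>u\<close> downwards preserves every old maximum. The
  only further upper spectrum, that of \<open>w\<close>, is the new color itself, so upper spectra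
  and colors stay equal as sets whether or not that color was used before.\<close>

lemma top_coloring_add_leaf:
  assumes col: "top_coloring V E \<alpha>" and u: "u \<in> V" and w: "w \<notin> V" and EV: "E \<subseteq> Pow V"
  shows "\<exists>\<beta>. top_coloring (insert w V) (insert {u, w} E) \<beta>"
proof -
  let ?E = "insert {u, w} E"
  let ?S = "\<lambda>v. \<alpha> ` {e\<in>E. v \<in> e}"
  have proper: "\<alpha> e \<noteq> \<alpha> f" if "e \<in> E" "f \<in> E" "e \<noteq> f" "e \<inter> f \<noteq> {}" for e f
    using top_coloringD(1)[OF col] that by simp
  obtain a b where ab: "\<alpha> ` E = {a..b}"
    using top_coloringD(2)[OF col] by blast
  have spec: "\<exists>c d. c \<le> d \<and> ?S v = {c..d}" if "v \<in> V" for v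
    using top_coloringD(3)[OF col] that by simp
  note tops = top_coloringD(4)[OF col]
  obtain m n where mn: "m \<le> n" "?S u = {m..n}"
    using spec[OF u] by blast
  have "?S u \<subseteq> \<alpha> ` E" by auto
  then have "a \<le> m" "n \<le> b" using mn ab by auto
  define \<beta> where "\<beta> = \<alpha>({u, w} := m - 1)"
  \<comment> \<open>As the edge is fresh, the update changes no old color.\<close>
  have new: "{u, w} \<notin> E" using EV w by auto
  have \<beta>_new: "\<beta> {u, w} = m - 1" by (simp add: \<beta>_def)
  have \<beta>_old: "\<beta> e = \<alpha> e" if "e \<in> E" for e
    using that new by (auto simp: \<beta>_def)
  have \<beta>_im: "\<beta> ` F = \<alpha> ` F" if "F \<subseteq> E" for F
    using that \<beta>_old by (intro image_cong) auto
  have img: "\<beta> ` ?E = insert (m - 1) {a..b}"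
    using \<beta>_im[of E] ab \<beta>_new by simp
  have spec_w: "\<beta> ` {e\<in>?E. w \<in> e} = {m - 1}"
  proof -
    have "{e\<in>?E. w \<in> e} = {{u, w}}" using EV w by auto
    then show ?thesis using \<beta>_new by simp
  qed
  have spec_u: "\<beta> ` {e\<in>?E. u \<in> e} = {m - 1..n}"
  proof -
    have "{e\<in>?E. u \<in> e} = insert {u, w} {e\<in>E. u \<in> e}" by auto
    then have "\<beta> ` {e\<in>?E. u \<in> e} = insert (m - 1) {m..n}"
      using \<beta>_new \<beta>_im[of "{e\<in>E. u \<in> e}"] mn(2) by simp
    also have "\<dots> = {m - 1..n}" using mn(1) by auto
    finally show ?thesis .
  qed
  have spec_other: "\<beta> ` {e\<in>?E. v \<in> e} = ?S v" if "v \<in> V" "v \<noteq> u" for v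
  proof -
    have "{e\<in>?E. v \<in> e} = {e\<in>E. v \<in> e}" using that w by auto
    then show ?thesis using \<beta>_im[of "{e\<in>E. v \<in> e}"] by auto
  qed
  have top_old: "Max (\<beta> ` {e\<in>?E. v \<in> e}) = Max (?S v)" if "v \<in> V" for v
  proof (cases "v = u")
    case True
    \<comment> \<open>The added color lies below a nonempty interval.\<close>
    have "Max {m - 1..n} = n" "Max {m..n} = n"
      using mn by (auto intro!: Max_eqI)
    then show ?thesis using True spec_u mn by simp
  next
    case False
    then show ?thesis using spec_other that by simp
  qed
  have proper_new: "\<beta> {u, w} \<noteq> \<beta> f" if "f \<in> E" "{u, w} \<inter> f \<noteq> {}" for f
  proof -
    \<comment> \<open>Old edges avoid \<open>w\<close>, so the shared endpoint must be
      \<open>u\<close>, where all old colors are at least \<open>m\<close>.\<close>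
    have "u \<in> f" using that EV w by auto
    then have "\<alpha> f \<in> {m..n}" using that mn(2) by blast
    then show ?thesis using \<beta>_new \<beta>_old that by auto
  qed
  have "\<beta> e \<noteq> \<beta> f" if "e \<in> ?E" "f \<in> ?E" "e \<noteq> f" "e \<inter> f \<noteq> {}" for e f
    using that proper_new[of f] proper_new[of e] proper[of e f] \<beta>_old
    by (smt (verit) Int_commute insert_iff)
  moreover have "\<exists>a b. \<beta> ` ?E = {a..b}"
  proof -
    \<comment> \<open>Since \<open>a \<le> m\<close>, the new color is at least
      \<open>a - 1\<close>: it extends the interval by one or already lies in it.\<close>
    have "insert (m - 1) {a..b} = {min a (m - 1)..b}"
      using \<open>a \<le> m\<close> \<open>n \<le> b\<close> \<open>m \<le> n\<close> by auto
    then show ?thesis using img by auto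
  qed
  moreover have "\<exists>a b. a \<le> b \<and> \<beta> ` {e\<in>?E. v \<in> e} = {a..b}" if v: "v \<in> insert w V" for v
  proof -
    consider "v = w" | "v = u" | "v \<in> V" "v \<noteq> u" using v by blast
    then show ?thesis
    proof cases
      case 1
      then show ?thesis using spec_w by (intro exI[of _ "m - 1"]) simp
    next
      case 2
      then show ?thesis using spec_u mn(1) by (intro exI[of _ "m - 1"] exI[of _ n]) simp
    next
      case 3
      then show ?thesis using spec_other spec by simp
    qed
  qed
  moreover have "(\<lambda>v. Max (\<beta> ` {e\<in>?E. v \<in> e})) ` insert w V = \<beta> ` ?E"
  proof -
    have "(\<lambda>v. Max (\<beta> ` {e\<in>?E. v \<in> e})) ` V = (\<lambda>v. Max (?S v)) ` V"
      by (rule image_cong[OF refl top_old])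
    also have "\<dots> = {a..b}" using tops ab by (rule trans)
    finally have old: "(\<lambda>v. Max (\<beta> ` {e\<in>?E. v \<in> e})) ` V = {a..b}" .
    show ?thesis
      unfolding image_insert[of _ w] spec_w img old by simp
  qed
  ultimately have "top_coloring (insert w V) ?E \<beta>"
    unfolding top_coloring_def by (intro conjI ballI impI) simp_all
  then show ?thesis by blast
qed

section \<open>Growing a subtree one leaf at a time\<close>

context pair_graph
begin

text \<open>Paths are taken in the whole graph and merely confined to \<open>S\<close>, so a cycle
  built from them contradicts acyclicity directly, without passing to an induced subgraph.\<close>

definition apath_connected :: "'a set \<Rightarrow> bool" where
  "apath_connected S \<longleftrightarrow>
     (\<forall>x\<in>S. \<forall>y\<in>S. \<exists>p. apath x p y \<and> set (awalk_verts x p) \<subseteq> S)"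

lemma apath_connected_insert:
  assumes S: "apath_connected S" and u: "u \<in> S" and w: "w \<notin> S" and arc: "(u, w) \<in> parcs G"
  shows "apath_connected (insert w S)"
  unfolding apath_connected_def
proof (intro ballI)
  have arc': "(w, u) \<in> parcs G" using arc by (rule arcs_symmetric)
  have wV: "w \<in> pverts G" using arc by (rule in_arcsD2)
  fix x y assume xy: "x \<in> insert w S" "y \<in> insert w S"
  consider "x \<in> S" "y \<in> S" | "x \<in> S" "y = w" | "x = w" "y \<in> S" | "x = w" "y = w"
    using xy by blast
  then show "\<exists>p. apath x p y \<and> set (awalk_verts x p) \<subseteq> insert w S"
  proof cases
    case 1
    then show ?thesis using S unfolding apath_connected_def by blast
  next
    case 2
    then obtain p where p: "apath x p u" "set (awalk_verts x p) \<subseteq> S"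
      using S u unfolding apath_connected_def by blast
    then have pw: "awalk x p u" by (simp add: apath_def)
    have walk: "awalk x (p @ [(u, w)]) w"
      using pw arc wV by (auto simp: awalk_simps)
    have "awalk_verts x (p @ [(u, w)]) = awalk_verts x p @ [w]"
      using awalk_verts_append[OF walk] pw by simp
    then show ?thesis
      using p w walk 2 by (intro exI[of _ "p @ [(u, w)]"]) (auto simp: apath_def)
  next
    case 3
    then obtain p where p: "apath u p y" "set (awalk_verts u p) \<subseteq> S"
      using S u unfolding apath_connected_def by blast
    then show ?thesis
      using arc' w 3 wV by (intro exI[of _ "(w, u) # p"]) (auto simp: apath_Cons_iff)
  next
    case 4
    then show ?thesis
      using wV by (intro exI[of _ "[]"]) (auto simp: apath_Nil_iff)
  qed
qed

text \<open>A path inside \<open>S\<close> between two distinct neighbours of \<open>w\<close>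
  avoids \<open>w\<close>, so closing it through \<open>w\<close> produces a forbidden
  cycle.\<close>

lemma apath_connected_unique_neighbour:
  assumes S: "apath_connected S"
    and acyclic: "\<not> (\<exists>p. cycle p \<and> 3 \<le> length p)"
    and u: "u \<in> S" "(u, w) \<in> parcs G" and v: "v \<in> S" "(v, w) \<in> parcs G" and w: "w \<notin> S"
  shows "u = v"
proof (rule ccontr)
  assume "u \<noteq> v"
  obtain p where p: "apath u p v" "set (awalk_verts u p) \<subseteq> S"
    using S u(1) v(1) unfolding apath_connected_def by blast
  then have pw: "awalk u p v" "distinct (awalk_verts u p)" by (simp_all add: apath_def)
  have wV: "w \<in> pverts G" using u(2) by (rule in_arcsD2)
  \<comment> \<open>This gives \<open>p\<close> at least one arc, and the closed walk at least
    three.\<close>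
  have "p \<noteq> []" using pw \<open>u \<noteq> v\<close> by (auto simp: awalk_Nil_iff)
  let ?c = "(w, u) # p @ [(v, w)]"
  have walk: "awalk u (p @ [(v, w)]) w"
    using pw v(2) wV by (auto simp: awalk_simps)
  then have cw: "awalk w ?c w"
    using arcs_symmetric[OF u(2)] wV by (auto simp: awalk_Cons_iff)
  have "awalk_verts u (p @ [(v, w)]) = awalk_verts u p @ [w]"
    using awalk_verts_append[OF walk] pw by simp
  \<comment> \<open>Dropping the start leaves \<open>w\<close> only at the end, after the vertices
    of \<open>p\<close>, which lie in \<open>S\<close>.\<close>
  then have "distinct (tl (awalk_verts w ?c))"
    using pw p w by auto
  then have "cycle ?c" using cw by (auto simp: cycle_def)
  moreover have "3 \<le> length ?c" using \<open>p \<noteq> []\<close> by (cases p) auto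
  ultimately show False using acyclic by blast
qed

text \<open>If no arc left \<open>S\<close>, everything reachable from \<open>S\<close> would stay
  in \<open>S\<close>.\<close>

lemma connected_boundary_arc:
  assumes conn: "connected (with_proj G)" and S: "S \<subset> pverts G" "S \<noteq> {}"
  shows "\<exists>u w. u \<in> S \<and> w \<notin> S \<and> (u, w) \<in> parcs G"
proof (rule ccontr)
  assume none: "\<not> ?thesis"
  obtain s t where st: "s \<in> S" "t \<in> pverts G" "t \<notin> S" using S by blast
  have "s \<rightarrow>\<^sup>*\<^bsub>mk_symmetric (with_proj G)\<^esub> t"
    using conn st S unfolding connected_def strongly_connected_def by auto
  \<comment> \<open>Connectedness refers to the symmetric closure, which adds nothing to a symmetric
    digraph.\<close>
  then have "s \<rightarrow>\<^sup>*\<^bsub>with_proj G\<^esub> t"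
    using reachable_mk_symmetric_eq pair_sym_arcs by simp
  then have "t \<in> S"
    by (induction rule: reachable_induct) (use none st in auto)
  then show False using st by simp
qed

text \<open>Without loops, an edge at \<open>w\<close> has its other end in \<open>S\<close>, and
  that end can only be \<open>u\<close>. This brings the induced edge set into the form needed by
  \<open>top_coloring_add_leaf\<close>.\<close>

lemma uedges_subset_insert:
  assumes "(u, w) \<in> parcs G" "u \<in> S" "\<And>v. v \<in> S \<Longrightarrow> (v, w) \<in> parcs G \<Longrightarrow> v = u"
  shows "{e \<in> uedges G. e \<subseteq> insert w S} = insert {u, w} {e \<in> uedges G. e \<subseteq> S}"
proof (intro equalityI subsetI)
  fix e assume "e \<in> {e \<in> uedges G. e \<subseteq> insert w S}"
  then obtain x y where e: "e = {x, y}" "(x, y) \<in> parcs G" "x \<in> insert w S" "y \<in> insert w S"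
    unfolding uedges_def by auto
  have "x \<noteq> y" using e(2) by (rule no_loops')
  show "e \<in> insert {u, w} {e \<in> uedges G. e \<subseteq> S}"
  proof (cases "w \<in> e")
    case True
    then have "e = {u, w}"
      using e \<open>x \<noteq> y\<close> assms(3)[of x] assms(3)[of y] arcs_symmetric[OF e(2)] by auto
    then show ?thesis by simp
  next
    case False
    then show ?thesis using e unfolding uedges_def by blast
  qed
next
  fix e assume "e \<in> insert {u, w} {e \<in> uedges G. e \<subseteq> S}"
  then show "e \<in> {e \<in> uedges G. e \<subseteq> insert w S}"
    using assms(1,2) unfolding uedges_def by auto
qed

text \<open>Induction on the order of the subtree, starting at 2 because a lone vertex has an empty
  spectrum. Path-connectedness is carried along because it makes the next attached vertex a
  leaf.\<close>

lemma tree_top_coloring_card: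
  assumes conn: "connected (with_proj G)"
    and acyclic: "\<not> (\<exists>p. cycle p \<and> 3 \<le> length p)"
    and n: "2 \<le> n" "n \<le> card (pverts G)"
  shows "\<exists>S \<alpha>. S \<subseteq> pverts G \<and> card S = n \<and> apath_connected S \<and>
           top_coloring S {e \<in> uedges G. e \<subseteq> S} \<alpha>"
  using n
proof (induction n rule: nat_induct_at_least)
  case base
  then obtain s where s: "s \<in> pverts G" by fastforce
  \<comment> \<open>The singleton is a proper subset, so an arc leaves it and supplies the first
    edge.\<close>
  have "card {s} \<noteq> card (pverts G)" using base by simp
  then have "{s} \<noteq> pverts G" by metis
  then obtain w where w: "w \<noteq> s" "(s, w) \<in> parcs G"
    using connected_boundary_arc[OF conn, of "{s}"] s by auto
  have "apath_connected {s}"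
    using s unfolding apath_connected_def
    by (simp add: apath_Nil_iff exI[of _ "[]"])
  then have "apath_connected {w, s}"
    using apath_connected_insert w by simp
  moreover have "{e \<in> uedges G. e \<subseteq> {s}} = {}"
    unfolding uedges_def using no_loops' by auto
  then have "{e \<in> uedges G. e \<subseteq> {w, s}} = {{s, w}}"
    using uedges_subset_insert[OF w(2), of "{s}"] by auto
  then have "top_coloring {w, s} {e \<in> uedges G. e \<subseteq> {w, s}} (\<lambda>_. 0)"
    using top_coloring_single_edge[of s w] by (simp add: insert_commute)
  moreover have "{w, s} \<subseteq> pverts G" "card {w, s} = 2"
    using s w in_arcsD2[OF w(2)] by auto
  ultimately show ?case by (intro exI conjI)
next
  case (Suc n)
  then obtain S \<alpha> where S: "S \<subseteq> pverts G" "card S = n" "apath_connected S"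
      "top_coloring S {e \<in> uedges G. e \<subseteq> S} \<alpha>"
    by auto
  have "S \<noteq> pverts G" "S \<noteq> {}" using S Suc by auto
  then obtain u w where uw: "u \<in> S" "w \<notin> S" "(u, w) \<in> parcs G"
    using connected_boundary_arc[OF conn, of S] S by auto
  \<comment> \<open>Acyclicity enters here: \<open>w\<close> has no neighbour in \<open>S\<close>
    other than \<open>u\<close>.\<close>
  have E: "{e \<in> uedges G. e \<subseteq> insert w S} = insert {u, w} {e \<in> uedges G. e \<subseteq> S}"
    using uw apath_connected_unique_neighbour[OF S(3) acyclic] by (intro uedges_subset_insert) auto
  have "{e \<in> uedges G. e \<subseteq> S} \<subseteq> Pow S" by auto
  from top_coloring_add_leaf[OF S(4) uw(1,2) this]
  obtain \<beta> where "top_coloring (insert w S) {e \<in> uedges G. e \<subseteq> insert w S} \<beta>"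
    unfolding E by (rule exE)
  moreover have "insert w S \<subseteq> pverts G" using S in_arcsD2[OF uw(3)] by simp
  moreover have "card (insert w S) = Suc n"
    using S uw finite_subset[OF S(1) pair_finite_verts] by simp
  moreover note apath_connected_insert[OF S(3) uw]
  ultimately show ?case by (intro exI conjI)
qed

text \<open>A subtree with as many vertices as the finite graph contains all vertices, and hence all
  edges.\<close>

lemma tree_top_coloring:
  assumes "connected (with_proj G)" "\<not> (\<exists>p. cycle p \<and> 3 \<le> length p)"
    and "2 \<le> card (pverts G)"
  shows "\<exists>\<alpha>. top_coloring (pverts G) (uedges G) \<alpha>"
proof -
  obtain S \<alpha> where S: "S \<subseteq> pverts G" "card S = card (pverts G)"
      "top_coloring S {e \<in> uedges G. e \<subseteq> S} \<alpha>"
    using tree_top_coloring_card[OF assms order_refl] by blast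
  have "S = pverts G" using S pair_finite_verts by (simp add: card_subset_eq)
  moreover have "{e \<in> uedges G. e \<subseteq> pverts G} = uedges G"
    unfolding uedges_def using wellformed' by auto
  ultimately show ?thesis using S by auto
qed

end

theorem theorem9:
  fixes T :: "'a pair_pre_digraph"
  assumes "undirected_tree T"
    and "card (pverts T) \<ge> 2"
  shows "\<exists>\<alpha>. interval_coloring T \<alpha> \<and> continuous_seq (USE T (pverts T) \<alpha>)"
proof -
  interpret pair_graph T using assms(1) by (simp add: undirected_tree_def)
  obtain \<alpha> where \<alpha>: "top_coloring (pverts T) (uedges T) \<alpha>"
    using tree_top_coloring assms unfolding undirected_tree_def by auto
  obtain a b where ab: "\<alpha> ` uedges T = {a..b}"
    using top_coloringD(2)[OF \<alpha>] by blast
  have tops: "upper_spectrum T \<alpha> ` pverts T = {a..b}"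
    using top_coloringD(4)[OF \<alpha>] ab by (simp add: upper_spectrum_def spectrum_def)
  have "pverts T \<noteq> {}" using assms(2) by auto
  then have "a \<le> b" using tops by auto
  have "proper_edge_coloring T \<alpha>"
    unfolding proper_edge_coloring_def by (rule top_coloringD(1)[OF \<alpha>])
  \<comment> \<open>The number of colors is \<open>b - a + 1\<close>; \<open>nat\<close> loses
    nothing because \<open>a \<le> b\<close>.\<close>
  moreover have "\<alpha> ` uedges T = {a..<a + int (nat (b - a + 1))}"
    using ab \<open>a \<le> b\<close> by auto
  moreover have "\<forall>v\<in>pverts T. int_interval (spectrum T \<alpha> v)"
    using top_coloringD(3)[OF \<alpha>] unfolding int_interval_def spectrum_def by blast
  ultimately have "interval_t_coloring T (nat (b - a + 1)) \<alpha>"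
    unfolding interval_t_coloring_def by blast
  \<comment> \<open>Sorting and multiplicities do not affect the underlying set, whose least and
    greatest elements are \<open>a\<close> and \<open>b\<close>.\<close>
  moreover have "set (USE T (pverts T) \<alpha>) = {a..b}"
    unfolding USE_def using tops pair_finite_verts by simp
  then have "continuous_seq (USE T (pverts T) \<alpha>)"
    using \<open>a \<le> b\<close> unfolding continuous_seq_def by (simp add: USE_def)
  ultimately show ?thesis unfolding interval_coloring_def by blast
qed

end
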